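(* Let $X$ be a Hilbert space. Let $m \geq 2$, let $\chi_1,\ldots,\chi_{m-1}:(0,\infty)\to(0,\infty)$ and $\nu_2,\ldots,\nu_m:(0,\infty)\to(0,\infty)$ be functions, and let $R_1,\ldots,R_m:X \to X$ be super strongly nonexpansive mappings such that, for all $i \in \{1,\ldots,m-1\}$, $R_i$ has SSNE-modulus $\chi_i$, and, for all $i \in \{2,\ldots,m\}$, $R_i$ has supercoercivity modulus $\nu_i$. Put $R:=R_m \circ\ldots\circ R_1$. Let $K: (0,\infty) \to (0,\infty)$ be such that for all $i\in\{1,\ldots,m\}$ and all $\varepsilon > 0$ there is a $p \in X$ with $\|p\| \leq K(\varepsilon)$ and $\|p-R_ip\| \leq \varepsilon$. Then for all $\delta > 0$ there is a $p \in X$ with $\|p\| \leq \Psi(m,\{\chi_i\}_{i=1}^{m-1},\{\nu_i\}_{i=2}^m,K,\delta)$ and $\|p-Rp\| \leq \delta$, where $\Psi$ is defined in the context.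
   Context: Notions. Let $X$ be a Hilbert space and $T:X\to X$. $T$ is nonexpansive if $\|Tx-Ty\|\le\|x-y\|$ for all $x,y$. $T$ is super strongly nonexpansive if it is nonexpansive and, for all sequences $(x_n),(y_n)\subseteq X$ with $\lim_n(\|x_n-y_n\|^2-\|Tx_n-Ty_n\|^2)=0$, one has $\lim_n((x_n-y_n)-(Tx_n-Ty_n))=0$. A function $\chi:(0,\infty)\to(0,\infty)$ is an SSNE-modulus for $T$ if for every $\varepsilon>0$ and all $x,y\in X$ with $\|x-y\|^2-\|Tx-Ty\|^2<\chi(\varepsilon)$ one has $\|(x-y)-(Tx-Ty)\|<\varepsilon$. A function $\nu:(0,\infty)\to(0,\infty)$ is a supercoercivity modulus for a super strongly nonexpansive $T$ if for all $M>0$ and all $x,y\in X$ with $\|x-y\|^2-\|Tx-Ty\|^2<M\|(x-y)-(Tx-Ty)\|$ one has $\|(x-y)-(Tx-Ty)\|<\nu(M)$. Auxiliary functions. For $\chi,\psi,\alpha,\nu,\eta:(0,\infty)\to(0,\infty)$ and $\varepsilon,N,L_1,L_2,L_3>0$ put: $$\psi_\chi(\varepsilon):=\frac{\chi(2\varepsilon)}4,\qquad \alpha_\psi(\varepsilon):=\min\left(\psi(\varepsilon/2),\varepsilon^2/4\right),$$ $$\beta_\alpha(\varepsilon):=\min(\alpha(1)/4,\alpha(\varepsilon))\text{ if }\varepsilon<1,\qquad \beta_\alpha(\varepsilon):=\alpha(1)/4\text{ if }\varepsilon\ge1,$$ $$L_\psi(\varepsilon):=\max\left(\frac{4\varepsilon}{\sqrt{1+4\beta_{\alpha_\psi}(\varepsilon)}-1},2\varepsilon\right),\qquad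 \eta_\nu(N):=\nu(2N)/2,$$ $$\rho(\eta,L_1,L_2,L_3):=2L_3+L_1L_3+\eta(2L_1+2L_2+2),$$ $$\Theta(\eta,L_1,L_2,L_3):=(L_1+L_2)(L_3+\rho(\eta,L_1,L_2,L_3)).$$ For $\chi,\nu,K:(0,\infty)\to(0,\infty)$ and $\delta>0$ put: $$B(\nu,K,\delta):=\sqrt{\left(K\left(\tfrac\delta4\right)+\tfrac\delta8\right)^2+2\Theta\left(\eta_\nu,K\left(\tfrac\delta4\right)+\tfrac\delta8,K\left(\tfrac\delta4\right)+\tfrac\delta8,\tfrac\delta8\right)},$$ $$G(\nu,K,\delta):=B(\nu,K,\delta)\cdot\max\left(\sqrt2,\frac{4B(\nu,K,\delta)}\delta\right),$$ $$H(\chi,\nu,K,\delta):=L_{\psi_\chi}\left(G(\nu,K,\delta)+K\left(\tfrac\delta4\right)+\tfrac\delta8\right),$$ $$\Phi(\chi,\nu,K,\delta):=G(\nu,K,\delta)+H(\chi,\nu,K,\delta)+\tfrac\delta8.$$ For $n\ge1$ and $\chi_1,\ldots,\chi_n:(0,\infty)\to(0,\infty)$ put $\chi_{\chi_1,\ldots,\chi_n}(\varepsilon):=\min\{\chi_i(\varepsilon/n)\mid 1\le i\le n\}$. Define recursively $\Psi(2,\{\chi_i\}_{i=1}^1,\{\nu_i\}_{i=2}^2,K,\delta):=\Phi(\chi_1,\nu_2,K,\delta)$ and, for $m\ge2$, $\Psi(m+1,\{\chi_i\}_{i=1}^{m},\{\nu_i\}_{i=2}^{m+1},K,\delta):=\Phi(\chi_{\chi_1,\ldots,\chi_m},\nu_{m+1},K',\delta)$,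 where $K'(r):=\max(\Psi(m,\{\chi_i\}_{i=1}^{m-1},\{\nu_i\}_{i=2}^m,K,r),K(r))$ for $r>0$. *)

theory Defs
  imports "HOL-Analysis.Analysis"
begin

text \<open>
  A function from the positive reals to the positive reals is rendered as a total function on
  \<^typ>\<open>real\<close> belonging to \<^term>\<open>{0<..} \<rightarrow> {0<..}\<close>; its values at nonpositive arguments are
  irrelevant, since all moduli below are evaluated at positive arguments only.
\<close>

definition nonexpansive :: "('a::real_normed_vector \<Rightarrow> 'a) \<Rightarrow> bool" where
  "nonexpansive T \<longleftrightarrow> (\<forall>x y. norm (T x - T y) \<le> norm (x - y))"

definition super_strongly_nonexpansive :: "('a::real_normed_vector \<Rightarrow> 'a) \<Rightarrow> bool" where
  "super_strongly_nonexpansive T \<longleftrightarrow>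
     nonexpansive T \<and>
     (\<forall>x y :: nat \<Rightarrow> 'a.
        (\<lambda>n. (norm (x n - y n))\<^sup>2 - (norm (T (x n) - T (y n)))\<^sup>2) \<longlonglongrightarrow> 0 \<longrightarrow>
        (\<lambda>n. (x n - y n) - (T (x n) - T (y n))) \<longlonglongrightarrow> 0)"

definition ssne_modulus :: "('a::real_normed_vector \<Rightarrow> 'a) \<Rightarrow> (real \<Rightarrow> real) \<Rightarrow> bool" where
  "ssne_modulus T chi \<longleftrightarrow>
     chi \<in> {0<..} \<rightarrow> {0<..} \<and>
     (\<forall>\<epsilon>>0. \<forall>x y. (norm (x - y))\<^sup>2 - (norm (T x - T y))\<^sup>2 < chi \<epsilon> \<longrightarrow>
        norm ((x - y) - (T x - T y)) < \<epsilon>)"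

definition supercoercivity_modulus ::
    "('a::real_normed_vector \<Rightarrow> 'a) \<Rightarrow> (real \<Rightarrow> real) \<Rightarrow> bool" where
  "supercoercivity_modulus T nu \<longleftrightarrow>
     nu \<in> {0<..} \<rightarrow> {0<..} \<and>
     (\<forall>M>0. \<forall>x y.
        (norm (x - y))\<^sup>2 - (norm (T x - T y))\<^sup>2 < M * norm ((x - y) - (T x - T y)) \<longrightarrow>
        norm ((x - y) - (T x - T y)) < nu M)"

definition psi_fun :: "(real \<Rightarrow> real) \<Rightarrow> real \<Rightarrow> real" where
  "psi_fun chi \<epsilon> = chi (2 * \<epsilon>) / 4"

definition alpha_fun :: "(real \<Rightarrow> real) \<Rightarrow> real \<Rightarrow> real" where
  "alpha_fun \<psi> \<epsilon> = min (\<psi> (\<epsilon> / 2)) (\<epsilon>\<^sup>2 / 4)"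

definition beta_fun :: "(real \<Rightarrow> real) \<Rightarrow> real \<Rightarrow> real" where
  "beta_fun \<alpha> \<epsilon> = (if \<epsilon> < 1 then min (\<alpha> 1 / 4) (\<alpha> \<epsilon>) else \<alpha> 1 / 4)"

definition L_fun :: "(real \<Rightarrow> real) \<Rightarrow> real \<Rightarrow> real" where
  "L_fun \<psi> \<epsilon> =
     max (4 * \<epsilon> / (sqrt (1 + 4 * beta_fun (alpha_fun \<psi>) \<epsilon>) - 1)) (2 * \<epsilon>)"

definition eta_fun :: "(real \<Rightarrow> real) \<Rightarrow> real \<Rightarrow> real" where
  "eta_fun nu N = nu (2 * N) / 2"

definition rho_bound :: "(real \<Rightarrow> real) \<Rightarrow> real \<Rightarrow> real \<Rightarrow> real \<Rightarrow> real" where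
  "rho_bound \<eta> L1 L2 L3 = 2 * L3 + L1 * L3 + \<eta> (2 * L1 + 2 * L2 + 2)"

definition Theta_bound :: "(real \<Rightarrow> real) \<Rightarrow> real \<Rightarrow> real \<Rightarrow> real \<Rightarrow> real" where
  "Theta_bound \<eta> L1 L2 L3 = (L1 + L2) * (L3 + rho_bound \<eta> L1 L2 L3)"

definition B_bound :: "(real \<Rightarrow> real) \<Rightarrow> (real \<Rightarrow> real) \<Rightarrow> real \<Rightarrow> real" where
  "B_bound nu K \<delta> =
     sqrt ((K (\<delta> / 4) + \<delta> / 8)\<^sup>2 +
       2 * Theta_bound (eta_fun nu) (K (\<delta> / 4) + \<delta> / 8) (K (\<delta> / 4) + \<delta> / 8) (\<delta> / 8))"

definition G_bound :: "(real \<Rightarrow> real) \<Rightarrow> (real \<Rightarrow> real) \<Rightarrow> real \<Rightarrow> real" where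
  "G_bound nu K \<delta> = B_bound nu K \<delta> * max (sqrt 2) (4 * B_bound nu K \<delta> / \<delta>)"

definition H_bound ::
    "(real \<Rightarrow> real) \<Rightarrow> (real \<Rightarrow> real) \<Rightarrow> (real \<Rightarrow> real) \<Rightarrow> real \<Rightarrow> real" where
  "H_bound chi nu K \<delta> = L_fun (psi_fun chi) (G_bound nu K \<delta> + K (\<delta> / 4) + \<delta> / 8)"

definition Phi_bound ::
    "(real \<Rightarrow> real) \<Rightarrow> (real \<Rightarrow> real) \<Rightarrow> (real \<Rightarrow> real) \<Rightarrow> real \<Rightarrow> real" where
  "Phi_bound chi nu K \<delta> = G_bound nu K \<delta> + H_bound chi nu K \<delta> + \<delta> / 8"

definition chi_comp :: "nat \<Rightarrow> (nat \<Rightarrow> real \<Rightarrow> real) \<Rightarrow> real \<Rightarrow> real" where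
  "chi_comp n chi \<epsilon> = Min ((\<lambda>i. chi i (\<epsilon> / real n)) ` {1..n})"

text \<open>
  Families are indexed by \<^typ>\<open>nat\<close>: the value at \<open>m \<ge> 2\<close> depends on \<open>chi\<close> at the indices
  \<open>1, \<dots>, m - 1\<close> and on \<open>nu\<close> at the indices \<open>2, \<dots>, m\<close> only. The values at \<open>m < 2\<close> are left
  unspecified.
\<close>

fun Psi_bound ::
    "nat \<Rightarrow> (nat \<Rightarrow> real \<Rightarrow> real) \<Rightarrow> (nat \<Rightarrow> real \<Rightarrow> real) \<Rightarrow> (real \<Rightarrow> real) \<Rightarrow> real \<Rightarrow> real" where
  "Psi_bound (Suc (Suc 0)) chi nu K \<delta> = Phi_bound (chi 1) (nu 2) K \<delta>"
| "Psi_bound (Suc (Suc (Suc n))) chi nu K \<delta> =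
     Phi_bound (chi_comp (n + 2) chi) (nu (n + 3))
       (\<lambda>r. max (Psi_bound (Suc (Suc n)) chi nu K r) (K r)) \<delta>"

primrec comp_upto :: "nat \<Rightarrow> (nat \<Rightarrow> 'a \<Rightarrow> 'a) \<Rightarrow> 'a \<Rightarrow> 'a" where
  "comp_upto 0 R = id"
| "comp_upto (Suc n) R = R (Suc n) \<circ> comp_upto n R"

end

theory Submission imports Defs
begin

text \<open>
  A nonexpansive map \<open>T\<close> is the reflected resolvent of the monotone operator \<open>C\<close> whose graph consists
  of the pairs \<open>((x + T x)/2, (x - T x)/2)\<close>. If \<open>v\<close> solves
  \<open>b\<^sub>1 + b\<^sub>2 - l v \<in> C\<^sub>1 v + C\<^sub>2 v\<close> with small \<open>l\<close> and \<open>b\<^sub>i\<close>, then \<open>x = v + u\<^sub>1\<close> with \<open>u\<^sub>1 \<in> C\<^sub>1 v\<close> is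
  almost fixed by \<open>R\<^sub>2 \<circ> R\<^sub>1\<close>. As in the Brezis-Haraux theorem, the rectangularity of \<open>C\<^sub>2\<close>, which comes
  from the supercoercivity modulus, bounds \<open>sqrt l * norm v\<close> independently of \<open>l\<close>; the SSNE-modulus
  bounds \<open>u\<^sub>1\<close> in terms of \<open>v\<close>. Compositions inherit an SSNE-modulus, so more than two maps are
  handled by induction.
\<close>

section \<open>Resolvent and displacement of a nonexpansive map\<close>

text \<open>The resolvent of the operator \<open>C\<close> attached to \<open>T\<close>: the unique
  \<open>v\<close> with \<open>x - v\<close> in \<open>C v\<close>, that element being
  \<open>disp T x\<close>.\<close>

definition mid :: "('a::real_normed_vector \<Rightarrow> 'a) \<Rightarrow> 'a \<Rightarrow> 'a" where
  "mid T x = (1/2) *\<^sub>R (x + T x)"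

definition disp :: "('a::real_normed_vector \<Rightarrow> 'a) \<Rightarrow> 'a \<Rightarrow> 'a" where
  "disp T x = (1/2) *\<^sub>R (x - T x)"

lemma mid_plus_disp: "mid T x + disp T x = x"
  by (simp add: mid_def disp_def flip: scaleR_add_right)

lemma mid_minus_disp: "mid T x - disp T x = T x"
  by (simp add: mid_def disp_def flip: scaleR_diff_right)

text \<open>Translates the quantity controlled by both moduli into the monotonicity pairing of
  \<open>C\<close>; nonexpansiveness of \<open>T\<close> thus becomes monotonicity.\<close>

lemma inner_mid_disp:
  fixes T :: "'a::real_inner \<Rightarrow> 'a"
  shows "(mid T x - mid T y) \<bullet> (disp T x - disp T y) =
    ((norm (x - y))\<^sup>2 - (norm (T x - T y))\<^sup>2) / 4"
  by (simp add: mid_def disp_def power2_norm_eq_inner inner_simps inner_commute field_simps)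

lemma norm_disp_diff:
  "norm ((x - y) - (T x - T y)) = 2 * norm (disp T x - disp T y)"
proof -
  have "(x - y) - (T x - T y) = 2 *\<^sub>R (disp T x - disp T y)"
    by (simp add: disp_def algebra_simps)
  then show ?thesis by simp
qed

context
  fixes T :: "'a::real_inner \<Rightarrow> 'a"
  assumes T: "nonexpansive T"
begin

lemma inner_mid_disp_nonneg: "0 \<le> (mid T x - mid T y) \<bullet> (disp T x - disp T y)"
  using T by (simp add: inner_mid_disp nonexpansive_def power_mono)

text \<open>Firm nonexpansiveness: expanding the square of \<open>mid + disp\<close>, the cross term
  is nonnegative by monotonicity.\<close>

lemma norm_sq_split:
  "(norm (mid T x - mid T y))\<^sup>2 + (norm (disp T x - disp T y))\<^sup>2 \<le> (norm (x - y))\<^sup>2"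
proof -
  have "x - y = (mid T x - mid T y) + (disp T x - disp T y)"
    by (metis add_diff_add mid_plus_disp)
  then show ?thesis
    using inner_mid_disp_nonneg[of x y]
    by (simp add: power2_norm_eq_inner inner_add_left inner_add_right inner_commute)
qed

lemma mid_nonexpansive: "norm (mid T x - mid T y) \<le> norm (x - y)"
proof (rule power2_le_imp_le)
  show "(norm (mid T x - mid T y))\<^sup>2 \<le> (norm (x - y))\<^sup>2"
    using norm_sq_split[of x y] zero_le_power2[of "norm (disp T x - disp T y)"] by linarith
qed simp

lemma disp_nonexpansive: "norm (disp T x - disp T y) \<le> norm (x - y)"
proof (rule power2_le_imp_le)
  show "(norm (disp T x - disp T y))\<^sup>2 \<le> (norm (x - y))\<^sup>2"
    using norm_sq_split[of x y] zero_le_power2[of "norm (mid T x - mid T y)"] by linarith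
qed simp

end

section \<open>Solving the regularised inclusion\<close>

text \<open>Substituting \<open>disp T x = x - mid T x\<close> turns the equation into a fixed point
  problem with contraction factor \<open>(l - e) / (1 + e)\<close>.\<close>

lemma mid_disp_combination_surj:
  fixes T :: "'a::{real_inner, complete_space} \<Rightarrow> 'a"
  assumes T: "nonexpansive T" and "0 < e" "e \<le> l" "l \<le> 1"
  shows "\<exists>x. (1 + l) *\<^sub>R mid T x + (1 + e) *\<^sub>R disp T x = q"
proof -
  define F where "F x = (1 / (1 + e)) *\<^sub>R (q - (l - e) *\<^sub>R mid T x)" for x
  have "dist (F x) (F y) \<le> ((l - e) / (1 + e)) * dist x y" for x y
  proof -
    have "F x - F y = ((l - e) / (1 + e)) *\<^sub>R (mid T y - mid T x)"
      by (simp add: F_def divide_inverse algebra_simps)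
    then have "dist (F x) (F y) = ((l - e) / (1 + e)) * norm (mid T x - mid T y)"
      using assms by (simp add: dist_norm norm_minus_commute)
    also have "\<dots> \<le> ((l - e) / (1 + e)) * norm (x - y)"
      using assms by (intro mult_left_mono mid_nonexpansive) auto
    finally show ?thesis by (simp add: dist_norm)
  qed
  then have "\<exists>!x. F x = x"
    using assms by (intro banach_fix_type[where c = "(l - e) / (1 + e)"]) auto
  then obtain x where "F x = x" by blast
  then have "(1 + e) *\<^sub>R x = (1 + e) *\<^sub>R F x" by simp
  then have "(1 + e) *\<^sub>R x = q - (l - e) *\<^sub>R mid T x"
    using assms by (simp add: F_def)
  then have "(1 + e) *\<^sub>R (mid T x + disp T x) = q - (l - e) *\<^sub>R mid T x"
    by (simp only: mid_plus_disp)
  then have "(1 + l) *\<^sub>R mid T x + (1 + e) *\<^sub>R disp T x = q"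
    by (simp add: algebra_simps)
  then show ?thesis ..
qed

text \<open>Comparing squares, the cross terms have favourable signs, and
  \<open>(1 - l) / (1 + l)\<close> is at most \<open>(1 - e) / (1 + e)\<close> because
  \<open>e \<le> l\<close>.\<close>

lemma norm_combination_contracts:
  fixes V U :: "'a::real_inner"
  assumes "0 \<le> V \<bullet> U" "0 < e" "e \<le> l" "l \<le> 1"
  shows "norm ((1 - l) *\<^sub>R V - (1 - e) *\<^sub>R U) \<le>
    ((1 - e) / (1 + e)) * norm ((1 + l) *\<^sub>R V + (1 + e) *\<^sub>R U)"
proof -
  define k where "k = (1 - e) / (1 + e)"
  have k: "0 \<le> k" "1 - e = k * (1 + e)" using assms by (auto simp: k_def)
  have "1 - l \<le> k * (1 + l)"
    using assms by (simp add: k_def field_simps)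
  then have kl: "(1 - l)\<^sup>2 \<le> (k * (1 + l))\<^sup>2" using assms by (intro power_mono) auto
  have *: "(norm ((1 - l) *\<^sub>R V - (1 - e) *\<^sub>R U))\<^sup>2 =
      (1 - l)\<^sup>2 * (V \<bullet> V) + (1 - e)\<^sup>2 * (U \<bullet> U) - 2 * ((1 - l) * (1 - e) * (V \<bullet> U))"
    unfolding power2_norm_eq_inner
    by (simp add: inner_simps inner_commute power2_eq_square algebra_simps)
  have **: "(k * norm ((1 + l) *\<^sub>R V + (1 + e) *\<^sub>R U))\<^sup>2 =
      (k * (1 + l))\<^sup>2 * (V \<bullet> V) + (k * (1 + e))\<^sup>2 * (U \<bullet> U) + 2 * (k\<^sup>2 * (1 + l) * (1 + e) * (V \<bullet> U))"
    unfolding power_mult_distrib power2_norm_eq_inner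
    by (simp add: inner_simps inner_commute power2_eq_square algebra_simps)
  have "(norm ((1 - l) *\<^sub>R V - (1 - e) *\<^sub>R U))\<^sup>2 \<le> (k * norm ((1 + l) *\<^sub>R V + (1 + e) *\<^sub>R U))\<^sup>2"
  proof -
    have "0 \<le> (1 - l) * (1 - e) * (V \<bullet> U)" "0 \<le> k\<^sup>2 * (1 + l) * (1 + e) * (V \<bullet> U)"
      using assms by auto
    moreover have "(1 - l)\<^sup>2 * (V \<bullet> V) \<le> (k * (1 + l))\<^sup>2 * (V \<bullet> V)"
      by (intro mult_right_mono kl) auto
    ultimately show ?thesis unfolding * ** k(2)[symmetric] by linarith
  qed
  then show ?thesis
    unfolding k_def[symmetric] by (rule power2_le_imp_le) (use k in auto)
qed

text \<open>
  The term with coefficient \<open>e\<close> turns the inclusion \<open>d - l v \<in> C\<^sub>1 v + C\<^sub>2 v\<close> for the monotone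
  operators with graphs \<open>{(mid R\<^sub>i x, disp R\<^sub>i x)}\<close> into a fixed point equation of a strict
  contraction, so that no maximality theorem for sums of monotone operators is needed.
\<close>

lemma regularised_system_solvable:
  fixes S T :: "'a::{real_inner, complete_space} \<Rightarrow> 'a"
  assumes S: "nonexpansive S" and T: "nonexpansive T" and e: "0 < e" "e \<le> l" "l \<le> 1"
  obtains x z where "mid T z = mid S x + e *\<^sub>R disp S x + c"
    and "disp T z = d - l *\<^sub>R mid S x - disp S x"
proof -
  obtain g where g: "(1 + l) *\<^sub>R mid S (g q) + (1 + e) *\<^sub>R disp S (g q) = q" for q
    using mid_disp_combination_surj[OF S e] by metis
  \<comment> \<open>Adding and subtracting the two target equations gives formulas for
    \<open>z\<close> and \<open>T z\<close> in terms of \<open>x\<close>. With \<open>w\<close> in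
    the role of \<open>T z\<close>, \<open>g\<close> recovers \<open>x\<close> from
    \<open>w\<close>, and \<open>h w\<close> is the resulting \<open>z\<close>; it remains to find a
    fixed point of \<open>T\<close> after \<open>h\<close>.\<close>
  define h where "h w = (1 - l) *\<^sub>R mid S (g (w - (c - d))) - (1 - e) *\<^sub>R disp S (g (w - (c - d))) + (c + d)"
    for w
  have "dist (T (h w)) (T (h w')) \<le> ((1 - e) / (1 + e)) * dist w w'" for w w'
  proof -
    define V where "V = mid S (g (w - (c - d))) - mid S (g (w' - (c - d)))"
    define U where "U = disp S (g (w - (c - d))) - disp S (g (w' - (c - d)))"
    have "(1 + l) *\<^sub>R V + (1 + e) *\<^sub>R U =
        ((1 + l) *\<^sub>R mid S (g (w - (c - d))) + (1 + e) *\<^sub>R disp S (g (w - (c - d)))) -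
        ((1 + l) *\<^sub>R mid S (g (w' - (c - d))) + (1 + e) *\<^sub>R disp S (g (w' - (c - d))))"
      unfolding V_def U_def scaleR_diff_right by simp
    also have "\<dots> = (w - (c - d)) - (w' - (c - d))"
      by (simp only: g)
    finally have 1: "norm ((1 + l) *\<^sub>R V + (1 + e) *\<^sub>R U) = dist w w'"
      by (simp add: dist_norm)
    have 2: "h w - h w' = (1 - l) *\<^sub>R V - (1 - e) *\<^sub>R U"
      by (simp add: h_def V_def U_def algebra_simps)
    have "0 \<le> V \<bullet> U"
      unfolding V_def U_def by (rule inner_mid_disp_nonneg[OF S])
    from norm_combination_contracts[OF this e] 1 2
    have "norm (h w - h w') \<le> ((1 - e) / (1 + e)) * dist w w'" by simp
    moreover have "dist (T (h w)) (T (h w')) \<le> norm (h w - h w')"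
      using T by (simp add: nonexpansive_def dist_norm)
    ultimately show ?thesis by simp
  qed
  then have "\<exists>!w. T (h w) = w"
    using e by (intro banach_fix_type[where c = "(1 - e) / (1 + e)"]) auto
  then obtain w where w: "T (h w) = w" by blast
  define x where "x = g (w - (c - d))"
  have "w = (1 + l) *\<^sub>R mid S x + (1 + e) *\<^sub>R disp S x + (c - d)"
    using g[of "w - (c - d)"] by (simp add: x_def)
  then have Th: "T (h w) = (1 + l) *\<^sub>R mid S x + (1 + e) *\<^sub>R disp S x + (c - d)"
    using w by simp
  have h: "h w = (1 - l) *\<^sub>R mid S x - (1 - e) *\<^sub>R disp S x + (c + d)"
    by (simp add: h_def x_def)
  have half: "(1/2) *\<^sub>R (a + a) = a" for a :: 'a
    by (simp flip: scaleR_2)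
  have "h w + T (h w) = (mid S x + e *\<^sub>R disp S x + c) + (mid S x + e *\<^sub>R disp S x + c)"
    unfolding Th unfolding h by (simp add: algebra_simps)
  then have m: "mid T (h w) = mid S x + e *\<^sub>R disp S x + c"
    by (simp only: mid_def[of T] half)
  have "h w - T (h w) = (d - l *\<^sub>R mid S x - disp S x) + (d - l *\<^sub>R mid S x - disp S x)"
    unfolding Th unfolding h by (simp add: algebra_simps)
  then have "disp T (h w) = d - l *\<^sub>R mid S x - disp S x"
    by (simp only: disp_def[of T] half)
  with m show thesis by (rule that)
qed

section \<open>Quantitative consequences of the two moduli\<close>

text \<open>Uniform monotonicity of the resolvent. One of \<open>disp\<close> and \<open>mid\<close>
  must move by at least \<open>t / 2\<close>: in the first case the contrapositive of the
  SSNE-modulus bounds the cross term from below, in the second the square of the \<open>mid\<close>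
  difference suffices.\<close>

lemma inner_mid_ge_alpha:
  fixes T :: "'a::real_inner \<Rightarrow> 'a"
  assumes T: "nonexpansive T" and chi: "ssne_modulus T chi" and "0 < t" "t \<le> norm (x - y)"
  shows "alpha_fun (psi_fun chi) t \<le> (mid T x - mid T y) \<bullet> (x - y)"
proof -
  define V where "V = mid T x - mid T y"
  define U where "U = disp T x - disp T y"
  have xy: "x - y = V + U"
    unfolding V_def U_def by (metis add_diff_add mid_plus_disp)
  have VU: "0 \<le> V \<bullet> U" unfolding V_def U_def by (rule inner_mid_disp_nonneg[OF T])
  have eq: "V \<bullet> (x - y) = V \<bullet> U + (norm V)\<^sup>2"
    by (simp add: xy inner_add_right power2_norm_eq_inner)
  show ?thesis
  proof (cases "t / 2 \<le> norm U")
    case True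
    have "\<not> (norm (x - y))\<^sup>2 - (norm (T x - T y))\<^sup>2 < chi t"
    proof
      assume "(norm (x - y))\<^sup>2 - (norm (T x - T y))\<^sup>2 < chi t"
      then have "norm ((x - y) - (T x - T y)) < t"
        using chi \<open>0 < t\<close> by (auto simp: ssne_modulus_def)
      then show False using True by (simp add: norm_disp_diff U_def)
    qed
    then have "psi_fun chi (t / 2) \<le> V \<bullet> U"
      by (simp add: V_def U_def inner_mid_disp psi_fun_def)
    then show ?thesis unfolding V_def[symmetric] eq
      by (auto simp: alpha_fun_def intro!: min.coboundedI1 add_increasing2)
  next
    case False
    have "norm (x - y) \<le> norm V + norm U" unfolding xy by (rule norm_triangle_ineq)
    with False assms have "t / 2 \<le> norm V" by simp
    then have "(t / 2)\<^sup>2 \<le> (norm V)\<^sup>2" using assms by (intro power_mono) auto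
    then show ?thesis unfolding V_def[symmetric] eq using VU
      by (simp add: alpha_fun_def min.coboundedI2 power_divide)
  qed
qed

text \<open>
  Adding up the local estimate over a subdivision of the segment from \<open>y\<close> to \<open>x\<close> into pieces of
  length in \<open>[1, 2)\<close> yields quadratic growth.
\<close>

lemma inner_ge_quadratic_of_local:
  fixes f :: "'a::real_inner \<Rightarrow> 'a"
  assumes f: "\<And>x y. 1 \<le> norm (x - y) \<Longrightarrow> a \<le> (f x - f y) \<bullet> (x - y)"
    and "0 \<le> a" and xy: "1 \<le> norm (x - y)"
  shows "a / 4 * (norm (x - y))\<^sup>2 \<le> (f x - f y) \<bullet> (x - y)"
proof -
  define n where "n = nat \<lfloor>norm (x - y)\<rfloor>"
  have n: "1 \<le> n" "real n \<le> norm (x - y)" "norm (x - y) < real n + 1"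
    using xy by (auto simp: n_def le_nat_iff)
  define p where "p k = y + (real k / real n) *\<^sub>R (x - y)" for k
  have p: "p 0 = y" "p n = x" using n by (auto simp: p_def)
  have step: "p (Suc k) - p k = (1 / real n) *\<^sub>R (x - y)" for k
    by (simp add: p_def add_divide_distrib scaleR_left_distrib)
  have "real n * a \<le> (f (p (Suc k)) - f (p k)) \<bullet> (x - y)" for k
  proof -
    have "1 \<le> norm (p (Suc k) - p k)"
      unfolding step norm_scaleR using n by (simp add: field_simps)
    from f[OF this] have "a \<le> (f (p (Suc k)) - f (p k)) \<bullet> (x - y) / real n"
      unfolding step inner_scaleR_right by simp
    then show ?thesis using n by (simp add: pos_le_divide_eq mult.commute)
  qed
  then have "(\<Sum>k<n. real n * a) \<le> (\<Sum>k<n. (f (p (Suc k)) - f (p k)) \<bullet> (x - y))"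
    by (intro sum_mono)
  also have "\<dots> = (f x - f y) \<bullet> (x - y)"
    using sum_lessThan_telescope[of "\<lambda>k. f (p k)" n] p by (simp flip: inner_sum_left)
  finally have 1: "(real n)\<^sup>2 * a \<le> (f x - f y) \<bullet> (x - y)"
    by (simp add: power2_eq_square)
  \<comment> \<open>The factor 4 comes from \<open>norm (x - y) < n + 1\<close> and
    \<open>n + 1 \<le> 2 * n\<close>.\<close>
  have "(norm (x - y))\<^sup>2 \<le> (2 * real n)\<^sup>2"
    using n by (intro power_mono) auto
  then have "a / 4 * (norm (x - y))\<^sup>2 \<le> a / 4 * (2 * real n)\<^sup>2"
    using \<open>0 \<le> a\<close> by (intro mult_left_mono) auto
  with 1 show ?thesis by (simp add: power2_eq_square algebra_simps)
qed

text \<open>For distant points, uniform monotonicity and Cauchy-Schwarz bound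
  \<open>norm (x - y)\<close>, and \<open>disp\<close> is nonexpansive; for close points
  nonexpansiveness alone suffices.\<close>

lemma norm_disp_le_L_fun:
  fixes T :: "'a::real_inner \<Rightarrow> 'a"
  assumes T: "nonexpansive T" and chi: "ssne_modulus T chi" and r: "0 < r"
    and le: "norm (mid T x - mid T y) \<le> r"
  shows "norm (disp T x - disp T y) \<le> L_fun (psi_fun chi) r"
proof (cases "r \<le> norm (x - y)")
  case False
  then have "norm (disp T x - disp T y) \<le> 2 * r"
    using disp_nonexpansive[OF T, of x y] r by linarith
  then show ?thesis by (simp add: L_fun_def)
next
  case True
  define \<alpha> where "\<alpha> = alpha_fun (psi_fun chi)"
  define \<beta> where "\<beta> = beta_fun \<alpha> r"
  define D where "D = norm (x - y)"
  have D: "0 < D" using True r unfolding D_def by linarith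
  have \<alpha>_pos: "0 < \<alpha> t" if "0 < t" for t
    using chi that by (auto simp: \<alpha>_def alpha_fun_def psi_fun_def ssne_modulus_def Pi_iff)
  then have \<beta>_pos: "0 < \<beta>" using r by (auto simp: \<beta>_def beta_fun_def)
  have inner: "\<alpha> t \<le> (mid T u - mid T v) \<bullet> (u - v)" if "0 < t" "t \<le> norm (u - v)" for t u v
    unfolding \<alpha>_def by (rule inner_mid_ge_alpha[OF T chi that])
  \<comment> \<open>The cases mirror \<open>beta_fun\<close>: from distance 1 on, quadratic growth
    with constant \<open>\<alpha> 1 / 4\<close> applies; below 1, the local bound
    \<open>\<alpha> r\<close> is used together with \<open>D \<le> 1\<close>.\<close>
  have "\<beta> * D\<^sup>2 \<le> (mid T x - mid T y) \<bullet> (x - y)"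
  proof (cases "1 \<le> D")
    case True
    have "\<beta> \<le> \<alpha> 1 / 4" unfolding \<beta>_def beta_fun_def by auto
    then have "\<beta> * D\<^sup>2 \<le> \<alpha> 1 / 4 * D\<^sup>2" by (intro mult_right_mono) auto
    also have "\<dots> \<le> (mid T x - mid T y) \<bullet> (x - y)"
      unfolding D_def
      by (rule inner_ge_quadratic_of_local) (use inner[of 1] \<alpha>_pos[of 1] True in \<open>auto simp: D_def\<close>)
    finally show ?thesis .
  next
    case False
    then have "\<beta> \<le> \<alpha> r" using \<open>r \<le> norm (x - y)\<close> by (simp add: \<beta>_def beta_fun_def D_def)
    moreover have "D\<^sup>2 \<le> 1" using False D by (simp add: power_le_one)
    ultimately have "\<beta> * D\<^sup>2 \<le> \<alpha> r * 1" using \<beta>_pos by (intro mult_mono) auto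
    also have "\<dots> \<le> (mid T x - mid T y) \<bullet> (x - y)" using inner[OF r True] by simp
    finally show ?thesis .
  qed
  also have "\<dots> \<le> norm (mid T x - mid T y) * D" unfolding D_def by (rule norm_cauchy_schwarz)
  also have "\<dots> \<le> r * D" using le D by (intro mult_right_mono) auto
  finally have \<beta>D: "\<beta> * D \<le> r" using D by (simp add: power2_eq_square)
  \<comment> \<open>Since \<open>(s - 1) * (s + 1) = 4 * \<beta>\<close> and \<open>s > 1\<close>,
    the bound \<open>D \<le> r / \<beta>\<close> implies the one written with the square root in
    \<open>L_fun\<close>.\<close>
  define s where "s = sqrt (1 + 4 * \<beta>)"
  have s: "1 < s" "s\<^sup>2 = 1 + 4 * \<beta>" using \<beta>_pos by (auto simp: s_def)
  have "(s - 1) * (s + 1) = 4 * \<beta>" using s(2) by (simp add: power2_eq_square algebra_simps)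
  moreover have "(s - 1) * D * 2 \<le> (s - 1) * D * (s + 1)" using s D by (intro mult_left_mono) auto
  ultimately have "(s - 1) * D * 2 \<le> 4 * \<beta> * D" by (metis mult.assoc mult.commute)
  then have "(s - 1) * D \<le> 4 * r" using \<beta>D r by (simp add: algebra_simps)
  then have "D \<le> 4 * r / (s - 1)" using s by (simp add: pos_le_divide_eq mult.commute)
  moreover have "norm (disp T x - disp T y) \<le> D"
    unfolding D_def by (rule disp_nonexpansive[OF T])
  ultimately show ?thesis
    by (simp add: L_fun_def s_def \<beta>_def \<alpha>_def max.coboundedI1)
qed

text \<open>The quantitative form of rectangularity in the sense of Brezis and Haraux.\<close>

lemma inner_ge_minus_Theta:
  fixes T :: "'a::real_inner \<Rightarrow> 'a"
  assumes T: "nonexpansive T" and nu: "supercoercivity_modulus T nu"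
    and a: "norm a \<le> L1" and q: "norm (mid T q) \<le> L2" and "0 \<le> L3"
  shows "- Theta_bound (eta_fun nu) L1 L2 L3 \<le> (mid T z - a) \<bullet> (disp T z - disp T q)"
proof -
  define U where "U = disp T z - disp T q"
  define N where "N = 2 * L1 + 2 * L2 + 2"
  have L: "0 \<le> L1" "0 \<le> L2" using a q norm_ge_zero order_trans by blast+
  then have N: "0 < N" by (simp add: N_def)
  have eta: "0 < eta_fun nu N"
    using nu N by (auto simp: eta_fun_def supercoercivity_modulus_def Pi_iff)
  have Theta: "(L1 + L2) * eta_fun nu N \<le> Theta_bound (eta_fun nu) L1 L2 L3"
    unfolding Theta_bound_def rho_bound_def N_def using L \<open>0 \<le> L3\<close> by (intro mult_left_mono) auto
  have "norm (mid T q - a) \<le> L1 + L2"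
    using norm_triangle_ineq4[of "mid T q" a] a q by simp
  then have "norm (mid T q - a) * norm U \<le> (L1 + L2) * norm U"
    by (intro mult_right_mono) auto
  then have *: "- ((L1 + L2) * norm U) \<le> (mid T q - a) \<bullet> U"
    using Cauchy_Schwarz_ineq2[of "mid T q - a" U] by linarith
  have split: "(mid T z - a) \<bullet> U = (mid T z - mid T q) \<bullet> U + (mid T q - a) \<bullet> U"
    by (simp add: inner_diff_left)
  have "- Theta_bound (eta_fun nu) L1 L2 L3 \<le> (mid T z - a) \<bullet> U"
  \<comment> \<open>Either the monotone part outweighs the possible loss
    \<open>(L1 + L2) * norm U\<close>, as \<open>N\<close> exceeds \<open>L1 + L2\<close>, or
    supercoercivity bounds \<open>norm U\<close> itself.\<close>
  proof (cases "N * norm U \<le> (mid T z - mid T q) \<bullet> U")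
    case True
    have "(L1 + L2) * norm U \<le> N * norm U"
      using L by (intro mult_right_mono) (auto simp: N_def)
    moreover have "0 \<le> Theta_bound (eta_fun nu) L1 L2 L3"
      using Theta L eta by (meson add_nonneg_nonneg less_imp_le mult_nonneg_nonneg order_trans)
    ultimately show ?thesis using True * split by linarith
  next
    case False
    \<comment> \<open>The pairing carries a factor 1/4 and \<open>U\<close> a factor 1/2, so the
      threshold \<open>N\<close> becomes \<open>2 * N\<close>, as in \<open>eta_fun\<close>.\<close>
    have "(norm (z - q))\<^sup>2 - (norm (T z - T q))\<^sup>2 < (2 * N) * norm ((z - q) - (T z - T q))"
      using False by (simp add: U_def inner_mid_disp norm_disp_diff)
    then have "norm ((z - q) - (T z - T q)) < nu (2 * N)"
      using nu N by (auto simp: supercoercivity_modulus_def)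
    then have "norm U \<le> eta_fun nu N" by (simp add: norm_disp_diff U_def eta_fun_def)
    then have "(L1 + L2) * norm U \<le> (L1 + L2) * eta_fun nu N"
      using L by (intro mult_left_mono) auto
    moreover have "0 \<le> (mid T z - mid T q) \<bullet> U"
      unfolding U_def by (rule inner_mid_disp_nonneg[OF T])
    ultimately show ?thesis using Theta * split by linarith
  qed
  then show ?thesis by (simp add: U_def)
qed

section \<open>Approximate fixed points of a composition of two maps\<close>

lemma approx_fixpoint_comp:
  fixes S T :: "'a::{real_inner, complete_space} \<Rightarrow> 'a"
  assumes S: "nonexpansive S" and T: "nonexpansive T"
    and chi: "ssne_modulus S chi" and nu: "supercoercivity_modulus T nu"
    and \<delta>: "0 < \<delta>"
    and p: "norm p \<le> K (\<delta> / 4)" "norm (p - S p) \<le> \<delta> / 4"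
    and q: "norm q \<le> K (\<delta> / 4)" "norm (q - T q) \<le> \<delta> / 4"
  shows "\<exists>x. norm x \<le> Phi_bound chi nu K \<delta> \<and> norm (x - T (S x)) \<le> \<delta>"
proof -
  define L where "L = K (\<delta> / 4) + \<delta> / 8"
  define \<Theta> where "\<Theta> = Theta_bound (eta_fun nu) L L (\<delta> / 8)"
  define B where "B = sqrt (L\<^sup>2 + 2 * \<Theta>)"
  define M where "M = max (sqrt 2) (4 * B / \<delta>)"
  define G where "G = B * M"
  define H where "H = L_fun (psi_fun chi) (G + L)"
  \<comment> \<open>Here \<open>s\<close> is the square root of \<open>l\<close>. The two entries of
    \<open>M\<close> ensure \<open>l \<le> 1 / 2\<close> and
    \<open>s * B \<le> \<delta> / 4\<close>, while \<open>s * norm V \<le> B\<close> will give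
    \<open>norm V \<le> G\<close>.\<close>
  define s where "s = 1 / M"
  define l where "l = s\<^sup>2"
  have Phi: "Phi_bound chi nu K \<delta> = G + H + \<delta> / 8"
    unfolding Phi_bound_def H_bound_def G_bound_def B_bound_def H_def G_def M_def B_def \<Theta>_def L_def
    by (simp add: add.assoc)
  have L: "0 < L" using order_trans[OF norm_ge_zero p(1)] \<delta> by (simp add: L_def)
  have b: "norm (disp S p) \<le> \<delta> / 8" "norm (disp T q) \<le> \<delta> / 8"
    using p q by (simp_all add: disp_def)
  have "mid S p = p - disp S p" "mid T q = q - disp T q"
    by (simp_all add: eq_diff_eq mid_plus_disp)
  then have a: "norm (mid S p) \<le> L" "norm (mid T q) \<le> L"
    using norm_triangle_ineq4[of p "disp S p"] norm_triangle_ineq4[of q "disp T q"] p q b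
    by (simp_all add: L_def)
  have rect: "- \<Theta> \<le> (mid T z - mid S p) \<bullet> (disp T z - disp T q)" for z
    unfolding \<Theta>_def using \<delta> by (intro inner_ge_minus_Theta T nu a) auto
  have \<Theta>: "0 \<le> \<Theta>" using rect[of q] by simp
  have B: "0 < B" using L \<Theta> by (simp add: B_def add_pos_nonneg)
  have M: "sqrt 2 \<le> M" "4 * B / \<delta> \<le> M" by (auto simp: M_def)
  have "0 < M" using M(1) by (rule less_le_trans[rotated]) auto
  then have s: "0 < s" by (simp add: s_def)
  have sB: "s * B \<le> \<delta> / 4" using M(2) \<delta> \<open>0 < M\<close> by (simp add: s_def field_simps)
  have "2 \<le> M\<^sup>2" using M(1) by (metis power_mono real_sqrt_ge_zero real_sqrt_pow2 zero_le_numeral)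
  then have l: "0 < l" "l \<le> 1 / 2"
    using s by (simp_all add: l_def s_def power_divide field_simps)
  have G: "0 < G" using B \<open>0 < M\<close> by (simp add: G_def)
  have H: "0 < H" using G L by (simp add: H_def L_fun_def less_max_iff_disj)
  \<comment> \<open>\<open>l \<le> 1 / 2\<close> makes \<open>sqrt Q < B\<close> strict, which leaves room for the error of the regularisation by \<open>e\<close>.\<close>
  define Q where "Q = L\<^sup>2 / 2 + 2 * \<Theta>"
  have Q: "0 \<le> Q" using \<Theta> by (simp add: Q_def)
  obtain e where e: "0 < e" "e < l" "sqrt (Q / (1 - e / 4)) + e * H / s < B"
  proof -
    have "((\<lambda>e. sqrt (Q / (1 - e / 4)) + e * H / s) \<longlongrightarrow> sqrt (Q / (1 - 0 / 4)) + 0 * H / s) (at_right 0)"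
      using s by (intro tendsto_intros) auto
    moreover have "sqrt (Q / (1 - 0 / 4)) + 0 * H / s < B"
      using L by (simp add: B_def Q_def)
    ultimately have "\<forall>\<^sub>F e in at_right 0. sqrt (Q / (1 - e / 4)) + e * H / s < B"
      by (rule order_tendstoD)
    moreover have "\<forall>\<^sub>F e in at_right 0. e \<in> {0<..<l}"
      using l by (intro eventually_at_right_real) auto
    ultimately have "\<forall>\<^sub>F e in at_right 0. e \<in> {0<..<l} \<and> sqrt (Q / (1 - e / 4)) + e * H / s < B"
      by eventually_elim simp
    then obtain e where "e \<in> {0<..<l} \<and> sqrt (Q / (1 - e / 4)) + e * H / s < B"
      using eventually_happens'[OF trivial_limit_at_right_real] by blast
    then show thesis by (intro that[of e]) auto
  qed
  have "0 < e" "e \<le> l" "l \<le> 1" using e l by auto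
  then obtain x z
    \<comment> \<open>The shift by \<open>e\<close> times \<open>disp S p\<close> makes the
      perturbation of \<open>mid S x\<close> exactly \<open>e\<close> times the difference
      \<open>U\<close> below, which is the quantity bounded by \<open>H\<close>.\<close>
    where mz: "mid T z = mid S x + e *\<^sub>R disp S x + - (e *\<^sub>R disp S p)"
      and dz: "disp T z = (disp S p + disp T q) - l *\<^sub>R mid S x - disp S x"
    using regularised_system_solvable[OF S T] by metis
  define V where "V = mid S x"
  define U where "U = disp S x - disp S p"
  define a1 where "a1 = mid S p"
  have 1: "0 \<le> (V - a1) \<bullet> U"
    unfolding V_def U_def a1_def by (rule inner_mid_disp_nonneg[OF S])
  have "mid T z - a1 = V - a1 + e *\<^sub>R U" "disp T z - disp T q = - U - l *\<^sub>R V"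
    unfolding mz dz V_def U_def by (simp_all add: algebra_simps)
  then have 2: "- \<Theta> \<le> (V - a1 + e *\<^sub>R U) \<bullet> (- U - l *\<^sub>R V)"
    using rect[of z, folded a1_def] by (simp only:)
  \<comment> \<open>Completing the square absorbs the terms in \<open>e\<close> of 2 into a small
    multiple of \<open>V \<bullet> V\<close>.\<close>
  have 3: "0 \<le> e * ((U + (l / 2) *\<^sub>R V) \<bullet> (U + (l / 2) *\<^sub>R V))" using e by simp
  have 4: "l * (V \<bullet> V) - l * (a1 \<bullet> V) \<le> \<Theta> + e * l\<^sup>2 / 4 * (V \<bullet> V)"
    using 1 2 3 by (simp add: inner_simps inner_commute power2_eq_square algebra_simps)
  have "norm a1 \<le> L" using a by (simp add: a1_def)
  then have "(norm a1)\<^sup>2 \<le> L\<^sup>2" by (simp add: power_mono)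
  moreover have "0 \<le> (a1 - V) \<bullet> (a1 - V)" by simp
  ultimately have "2 * (a1 \<bullet> V) \<le> L\<^sup>2 + V \<bullet> V"
    by (simp add: inner_simps inner_commute power2_norm_eq_inner)
  then have "l * (2 * (a1 \<bullet> V)) \<le> l * (L\<^sup>2 + V \<bullet> V)" using l by (intro mult_left_mono) auto
  with 4 have 5: "l * (V \<bullet> V) \<le> l * L\<^sup>2 + 2 * \<Theta> + e * l * (l * (V \<bullet> V)) / 2"
    by (simp add: algebra_simps power2_eq_square)
  \<comment> \<open>Using \<open>l \<le> 1 / 2\<close> here produces both the summand
    \<open>L^2 / 2\<close> of \<open>Q\<close> and the factor \<open>1 - e / 4\<close>.\<close>
  have "l * L\<^sup>2 \<le> 1 / 2 * L\<^sup>2" using l by (intro mult_right_mono) auto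
  moreover have "e * l * (l * (V \<bullet> V)) \<le> e * (1 / 2) * (l * (V \<bullet> V))"
    using l e by (intro mult_right_mono mult_left_mono) auto
  ultimately have "(1 - e / 4) * (l * (V \<bullet> V)) \<le> Q"
    using 5 by (simp add: Q_def algebra_simps)
  then have "(s * norm V)\<^sup>2 \<le> Q / (1 - e / 4)"
    using e l by (simp add: l_def power_mult_distrib power2_norm_eq_inner pos_le_divide_eq mult.commute)
  then have "s * norm V \<le> sqrt (Q / (1 - e / 4))"
    by (rule real_le_rsqrt)
  then have sV: "s * norm V + e * H / s < B" using e by simp
  moreover have "0 \<le> e * H / s" using e H s by simp
  ultimately have "s * norm V \<le> B" by linarith
  then have VG: "norm V \<le> G" using \<open>0 < M\<close> by (simp add: s_def G_def field_simps)
  then have "norm (V - a1) \<le> G + L"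
    using norm_triangle_ineq4[of V a1] \<open>norm a1 \<le> L\<close> by linarith
  then have UH: "norm U \<le> H"
    unfolding U_def H_def V_def a1_def using G L by (intro norm_disp_le_L_fun S chi) auto
  have x: "x = V + U + disp S p"
    using mid_plus_disp[of S x] by (simp add: V_def U_def)
  have "norm x \<le> norm V + norm U + norm (disp S p)"
    unfolding x by (meson add_right_mono norm_triangle_ineq order_trans)
  then have "norm x \<le> Phi_bound chi nu K \<delta>" using VG UH b by (simp add: Phi)
  moreover have "norm (x - T (S x)) \<le> \<delta>"
  proof -
    \<comment> \<open>For \<open>e = 0\<close> both \<open>x - T z\<close> and
      \<open>z - S x\<close> would equal \<open>E\<close>; nonexpansiveness of \<open>T\<close>
      carries the second error over to \<open>T z - T (S x)\<close>.\<close>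
    define E where "E = disp S p + disp T q - l *\<^sub>R V"
    have mE: "mid T z = V + e *\<^sub>R U"
      using mz by (simp add: V_def U_def scaleR_diff_right)
    have dE: "disp T z = E - disp S x"
      using dz by (simp add: E_def V_def)
    have "z - S x = (mid T z + disp T z) - (V - disp S x)"
      by (simp only: V_def mid_plus_disp mid_minus_disp)
    then have zS: "z - S x = E + e *\<^sub>R U" by (simp add: mE dE)
    have "x - T z = (V + disp S x) - (mid T z - disp T z)"
      by (simp only: V_def mid_plus_disp mid_minus_disp)
    then have "x - T z = E - e *\<^sub>R U" by (simp add: mE dE)
    then have "norm (x - T z) \<le> norm E + e * norm U"
      using norm_triangle_ineq4[of E "e *\<^sub>R U"] e by simp
    moreover have "norm (T z - T (S x)) \<le> norm E + e * norm U"
    proof -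
      have "norm (T z - T (S x)) \<le> norm (z - S x)" using T unfolding nonexpansive_def by blast
      also have "\<dots> \<le> norm E + e * norm U"
        unfolding zS using norm_triangle_ineq[of E "e *\<^sub>R U"] e by simp
      finally show ?thesis .
    qed
    moreover have "norm E \<le> \<delta> / 4 + l * norm V"
      unfolding E_def
      using norm_triangle_ineq4[of "disp S p + disp T q" "l *\<^sub>R V"]
        norm_triangle_ineq[of "disp S p" "disp T q"] b l by simp
    moreover have "e * norm U \<le> e * H" using UH e by (intro mult_left_mono) auto
    moreover have "l * norm V + e * H \<le> \<delta> / 4"
    proof -
      \<comment> \<open>The summand \<open>e * H / s\<close> kept in \<open>sV\<close> is spent
        here, so both errors fit into the single budget \<open>s * B\<close>.\<close>
      have "l * norm V + e * H = s * (s * norm V + e * H / s)"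
        using s by (simp add: l_def power2_eq_square algebra_simps)
      also have "\<dots> \<le> s * B" using sV s by (intro mult_left_mono) auto
      finally show ?thesis using sB by simp
    qed
    moreover have "norm (x - T (S x)) \<le> norm (x - T z) + norm (T z - T (S x))"
      using dist_triangle[of x "T (S x)" "T z"] by (simp add: dist_norm)
    ultimately show ?thesis by linarith
  qed
  ultimately show ?thesis by blast
qed

section \<open>Compositions of several maps\<close>

lemma nonexpansive_comp_upto:
  assumes "\<And>i. i \<in> {1..n} \<Longrightarrow> nonexpansive (R i)"
  shows "nonexpansive (comp_upto n R)"
  using assms
proof (induction n)
  case (Suc n)
  then have "nonexpansive (R (Suc n))" "nonexpansive (comp_upto n R)" by auto
  then show ?case unfolding nonexpansive_def comp_upto.simps comp_apply by (meson order_trans)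
qed (simp add: nonexpansive_def)

text \<open>The squared distance decreases at every stage, so each single decrease is at most the
  total one. Each modulus then applies at \<open>\<epsilon> / n\<close>, and the \<open>n\<close>
  displacements telescope.\<close>

lemma ssne_modulus_comp_upto:
  fixes R :: "nat \<Rightarrow> 'a::real_normed_vector \<Rightarrow> 'a"
  assumes ne: "\<And>i. i \<in> {1..n} \<Longrightarrow> nonexpansive (R i)"
    and chi: "\<And>i. i \<in> {1..n} \<Longrightarrow> ssne_modulus (R i) (chi i)" and n: "1 \<le> n"
  shows "ssne_modulus (comp_upto n R) (chi_comp n chi)"
  unfolding ssne_modulus_def
proof (intro conjI allI impI)
  show "chi_comp n chi \<in> {0<..} \<rightarrow> {0<..}"
    using n chi by (auto simp: chi_comp_def ssne_modulus_def Pi_iff)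
next
  fix \<epsilon> :: real and x y :: 'a
  assume \<epsilon>: "0 < \<epsilon>"
    and less: "(norm (x - y))\<^sup>2 - (norm (comp_upto n R x - comp_upto n R y))\<^sup>2 < chi_comp n chi \<epsilon>"
  define d where "d k = comp_upto k R x - comp_upto k R y" for k
  have dec: "norm (d (Suc k)) \<le> norm (d k)" if "k < n" for k
    using ne[of "Suc k"] that by (auto simp: d_def nonexpansive_def)
  have dec2: "(norm (d (Suc k)))\<^sup>2 \<le> (norm (d k))\<^sup>2" if "k < n" for k
    using dec[OF that] by (simp add: power_mono)
  have step: "norm (d k - d (Suc k)) < \<epsilon> / n" if "k < n" for k
  proof -
    have "(norm (d k))\<^sup>2 - (norm (d (Suc k)))\<^sup>2 \<le> (\<Sum>j<n. (norm (d j))\<^sup>2 - (norm (d (Suc j)))\<^sup>2)"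
      using that dec2 by (intro member_le_sum[of k "{..<n}" "\<lambda>j. (norm (d j))\<^sup>2 - (norm (d (Suc j)))\<^sup>2"]) auto
    also have "\<dots> = (norm (d 0))\<^sup>2 - (norm (d n))\<^sup>2"
      by (rule sum_lessThan_telescope')
    also have "\<dots> < chi_comp n chi \<epsilon>" using less by (simp add: d_def)
    also have "\<dots> \<le> chi (Suc k) (\<epsilon> / n)"
      unfolding chi_comp_def using that by (intro Min_le) auto
    finally show ?thesis
      using chi[of "Suc k"] that \<epsilon> n by (auto simp: d_def ssne_modulus_def)
  qed
  have "norm (d 0 - d n) = norm (\<Sum>k<n. d k - d (Suc k))"
    by (simp add: sum_lessThan_telescope')
  also have "\<dots> \<le> (\<Sum>k<n. norm (d k - d (Suc k)))" by (rule norm_sum)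
  also have "\<dots> < (\<Sum>k<n. \<epsilon> / n)" using step n by (intro sum_strict_mono) (auto simp: lessThan_empty_iff)
  also have "\<dots> = \<epsilon>" using n by simp
  finally show "norm (x - y - (comp_upto n R x - comp_upto n R y)) < \<epsilon>"
    by (simp add: d_def)
qed

theorem theorem4p7:
  fixes R :: "nat \<Rightarrow> 'a::{real_inner, complete_space} \<Rightarrow> 'a"
    and chi nu :: "nat \<Rightarrow> real \<Rightarrow> real"
    and K :: "real \<Rightarrow> real"
    and m :: nat
  assumes "m \<ge> 2"
    and "\<forall>i\<in>{1..m-1}. chi i \<in> {0<..} \<rightarrow> {0<..}"
    and "\<forall>i\<in>{2..m}. nu i \<in> {0<..} \<rightarrow> {0<..}"
    and "\<forall>i\<in>{1..m}. super_strongly_nonexpansive (R i)"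
    and "\<forall>i\<in>{1..m-1}. ssne_modulus (R i) (chi i)"
    and "\<forall>i\<in>{2..m}. supercoercivity_modulus (R i) (nu i)"
    and "K \<in> {0<..} \<rightarrow> {0<..}"
    and "\<forall>i\<in>{1..m}. \<forall>\<epsilon>>0. \<exists>p. norm p \<le> K \<epsilon> \<and> norm (p - R i p) \<le> \<epsilon>"
  shows "\<forall>\<delta>>0. \<exists>p. norm p \<le> Psi_bound m chi nu K \<delta> \<and> norm (p - comp_upto m R p) \<le> \<delta>"
proof -
  have ne: "nonexpansive (R i)" if "i \<in> {1..m}" for i
    using assms(4) that by (simp add: super_strongly_nonexpansive_def)
  have fixp: "\<exists>p. norm p \<le> K \<epsilon> \<and> norm (p - R i p) \<le> \<epsilon>" if "i \<in> {1..m}" "0 < \<epsilon>" for i \<epsilon>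
    using assms(8) that by blast
  \<comment> \<open>The index is shifted by 2 to match the recursion of \<open>Psi_bound\<close>,
    which starts with two maps.\<close>
  have "\<forall>\<delta>>0. \<exists>p. norm p \<le> Psi_bound (n + 2) chi nu K \<delta> \<and> norm (p - comp_upto (n + 2) R p) \<le> \<delta>"
    if "n + 2 \<le> m" for n
    using that
  proof (induction n)
    case 0
    show ?case
    proof (intro allI impI)
      fix \<delta> :: real assume \<delta>: "0 < \<delta>"
      obtain p q where "norm p \<le> K (\<delta> / 4)" "norm (p - R 1 p) \<le> \<delta> / 4"
        and "norm q \<le> K (\<delta> / 4)" "norm (q - R 2 q) \<le> \<delta> / 4"
        using fixp[of 1 "\<delta> / 4"] fixp[of 2 "\<delta> / 4"] \<open>m \<ge> 2\<close> \<delta> by auto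
      then have "\<exists>x. norm x \<le> Phi_bound (chi 1) (nu 2) K \<delta> \<and> norm (x - R 2 (R 1 x)) \<le> \<delta>"
        using assms(5,6) \<open>m \<ge> 2\<close> \<delta> ne[of 1] ne[of 2]
        by (intro approx_fixpoint_comp[where p = p and q = q]) simp_all
      then show "\<exists>p. norm p \<le> Psi_bound (0 + 2) chi nu K \<delta> \<and> norm (p - comp_upto (0 + 2) R p) \<le> \<delta>"
        by (simp add: numeral_2_eq_2)
    qed
  next
    case (Suc n)
    \<comment> \<open>One radius must serve both maps: the inductive bound for the composition so
      far and \<open>K\<close> for the next map.\<close>
    define K' where "K' r = max (Psi_bound (n + 2) chi nu K r) (K r)" for r
    show ?case
    proof (intro allI impI)
      fix \<delta> :: real assume \<delta>: "0 < \<delta>"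
      obtain p where "norm p \<le> Psi_bound (n + 2) chi nu K (\<delta> / 4)"
        "norm (p - comp_upto (n + 2) R p) \<le> \<delta> / 4"
        using Suc.IH Suc.prems \<delta> by (auto dest!: spec[of _ "\<delta> / 4"])
      moreover obtain q where "norm q \<le> K (\<delta> / 4)" "norm (q - R (n + 3) q) \<le> \<delta> / 4"
        using fixp[of "n + 3" "\<delta> / 4"] Suc.prems \<delta> by auto
      moreover have "nonexpansive (comp_upto (n + 2) R)"
        using Suc.prems by (intro nonexpansive_comp_upto ne) auto
      moreover have "ssne_modulus (comp_upto (n + 2) R) (chi_comp (n + 2) chi)"
        using Suc.prems assms(5) by (intro ssne_modulus_comp_upto ne) auto
      ultimately have "\<exists>x. norm x \<le> Phi_bound (chi_comp (n + 2) chi) (nu (n + 3)) K' \<delta> \<and>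
          norm (x - R (n + 3) (comp_upto (n + 2) R x)) \<le> \<delta>"
        using assms(6) Suc.prems \<delta> ne[of "n + 3"]
        by (intro approx_fixpoint_comp[where S = "comp_upto (n + 2) R" and T = "R (n + 3)"
              and p = p and q = q])
          (simp_all add: K'_def max.coboundedI1 max.coboundedI2 del: comp_upto.simps)
      moreover have "Psi_bound (Suc n + 2) chi nu K \<delta> =
          Phi_bound (chi_comp (n + 2) chi) (nu (n + 3)) K' \<delta>"
        by (simp add: K'_def[abs_def])
      moreover have "comp_upto (Suc n + 2) R x = R (n + 3) (comp_upto (n + 2) R x)" for x
        by (simp add: eval_nat_numeral)
      ultimately show "\<exists>p. norm p \<le> Psi_bound (Suc n + 2) chi nu K \<delta> \<and>
          norm (p - comp_upto (Suc n + 2) R p) \<le> \<delta>" by metis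
    qed
  qed
  from this[of "m - 2"] \<open>m \<ge> 2\<close> show ?thesis
    by (simp only: le_add_diff_inverse2 order_refl simp_thms True_implies_equals)
qed

end
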